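(* Let $Z_3(n)=\sum_{p\vdash n}\mathrm{Sym}(p)$, the sum being over all partitions of $n$. For integers $0\le K\le n$ let $$S_{3;1;K}(n)=n!\Bigl(1+\sum_{k=2}^{K}\frac{1}{n(n-1)\cdots(n-k+1)}\sum_{\substack{q\vdash k\\ q_1=0}}\mathrm{Sym}(q)\Bigr).$$ Then $Z_3(n)$ is asymptotic, as $n\to\infty$, to the sequence $(S_{3;1;K}(n))_{K\ge0}$, in the sense that for every fixed integer $K\ge 0$, $$\lim_{n\to\infty} n^K\left(\frac{Z_3(n)}{n!}-\frac{S_{3;1;K}(n)}{n!}\right)=0.$$
   Context: A partition $p\vdash n$ is specified by non-negative integers $(p_1,\dots,p_n)$ with $\sum_i i\,p_i=n$, where $p_i$ is the number of parts of length $i$. Its symmetry factor is $\mathrm{Sym}(p)=\prod_{i=1}^n i^{p_i}\,p_i!$ (the order of the centralizer in $S_n$ of a permutation with cycle type $p$). The condition $q_1=0$ means that $q$ has no part equal to $1$. An empty sum is $0$. *)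

theory Defs
  imports Complex_Main
begin

text \<open>A partition of \<open>n\<close> is given by its multiplicities: \<open>p i\<close> is the number of parts equal
  to \<open>i\<close>. The tuple \<open>(p\<^sub>1, \<dots>, p\<^sub>n)\<close> is extended by 0 to all indices, so that each partition
  is represented by exactly one function.\<close>

definition partitions :: "nat \<Rightarrow> (nat \<Rightarrow> nat) set" where
  "partitions n = {p. (\<forall>i. i \<notin> {1..n} \<longrightarrow> p i = 0) \<and> (\<Sum>i=1..n. i * p i) = n}"

lemma finite_partitions: "finite (partitions n)"
proof (rule finite_subset)
  show "partitions n \<subseteq> {p. \<forall>i. (i \<in> {1..n} \<longrightarrow> p i \<in> {..n}) \<and> (i \<notin> {1..n} \<longrightarrow> p i = 0)}"
  proof safe
    fix p i assume p: "p \<in> partitions n" and i: "i \<in> {1..n}"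
    have "p i \<le> i * p i" using i by simp
    also have "\<dots> \<le> (\<Sum>i=1..n. i * p i)"
      using i by (intro member_le_sum) auto
    also have "\<dots> = n" using p by (simp add: partitions_def)
    finally show "p i \<le> n" .
  qed (auto simp: partitions_def)
  show "finite {p. \<forall>i. (i \<in> {1..n} \<longrightarrow> p i \<in> {..n}) \<and> (i \<notin> {1..n} \<longrightarrow> p i = (0::nat))}"
    by (rule finite_set_of_finite_funs) auto
qed

definition Sym :: "nat \<Rightarrow> (nat \<Rightarrow> nat) \<Rightarrow> nat" where
  "Sym n p = (\<Prod>i=1..n. i ^ p i * fact (p i))"

definition Z3 :: "nat \<Rightarrow> nat" where
  "Z3 n = (\<Sum>p\<in>partitions n. Sym n p)"

text \<open>The denominator below is the falling factorial \<open>n (n - 1) \<dots> (n - k + 1)\<close>. The definition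
  is only meaningful for \<open>K \<le> n\<close>; for \<open>k > n\<close> the denominator vanishes.\<close>

definition S31 :: "nat \<Rightarrow> nat \<Rightarrow> real" where
  "S31 K n = fact n *
     (1 + (\<Sum>k=2..K. 1 / (\<Prod>i<k. real n - real i) *
                      real (\<Sum>q\<in>{q \<in> partitions k. q 1 = 0}. Sym k q)))"

end

theory Submission
  imports Defs "HOL-Library.FuncSet"
begin

text \<open>Splitting the \<open>p\<^sub>1\<close> parts equal to 1 off a partition of \<open>n\<close> gives
  \<open>Z\<^sub>3(n) / n! = \<Sum>\<^sub>k W(k) / (n (n - 1) \<dots> (n - k + 1))\<close>, where \<open>W(k)\<close> is the sum of \<open>Sym(q)\<close> over
  the partitions \<open>q\<close> of \<open>k\<close> without parts equal to 1. Such a \<open>q\<close> has at most \<open>k / 2\<close> parts, so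
  \<open>W(k) \<le> 8\<^sup>k (k div 2)!\<close>. The error term is the sum over \<open>k > K\<close> of \<open>W(k) / k!\<close> divided by
  \<open>n choose k\<close>; as \<open>(n choose k) \<ge> (n / k)\<^sup>k \<ge> (n / k)\<^bsup>K + 1\<^esup>\<close>, it is at most
  \<open>n\<^bsup>-K - 1\<^esup>\<close> times the convergent series of \<open>k\<^bsup>K + 1\<^esup> W(k) / k!\<close>.\<close>

section \<open>Partitions without parts equal to 1 and the splitting of a partition\<close>

definition no_one_partitions :: "nat \<Rightarrow> (nat \<Rightarrow> nat) set" where
  "no_one_partitions k = {q \<in> partitions k. q 1 = 0}"

text \<open>This is \<open>W(k)\<close> of the overview.\<close>

definition no_one_sum :: "nat \<Rightarrow> nat" where
  "no_one_sum k = (\<Sum>q\<in>no_one_partitions k. Sym k q)"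

lemma finite_no_one_partitions: "finite (no_one_partitions k)"
  using finite_partitions by (simp add: no_one_partitions_def)

lemma partitions_mult_le:
  assumes "p \<in> partitions n"
  shows "i * p i \<le> n"
proof (cases "i \<in> {1..n}")
  case True
  then have "i * p i \<le> (\<Sum>i=1..n. i * p i)"
    by (intro member_le_sum) auto
  then show ?thesis using assms by (simp add: partitions_def)
next
  case False
  then show ?thesis using assms unfolding partitions_def by force
qed

text \<open>A part larger than \<open>k\<close> would alone exceed the total \<open>k\<close>, so
  the support may be checked on the larger range \<open>{1..n}\<close>. This serves to recognise
  what remains of a partition of \<open>n\<close> once its ones are removed.\<close>

lemma partitionsI:
  assumes "k \<le> n" and "\<And>i. i \<notin> {1..n} \<Longrightarrow> q i = 0" and "(\<Sum>i=1..n. i * q i) = k"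
  shows "q \<in> partitions k"
proof -
  have zero: "q i = 0" if "i \<notin> {1..k}" for i
  proof (cases "i \<in> {1..n}")
    case True
    then have "i * q i \<le> (\<Sum>i=1..n. i * q i)"
      by (intro member_le_sum) auto
    then have "i * q i \<le> k" using assms(3) by simp
    moreover have "i > k" using that True by auto
    ultimately show ?thesis by (cases "q i") auto
  qed (use assms(2) in auto)
  have "(\<Sum>i=1..k. i * q i) = (\<Sum>i=1..n. i * q i)"
    by (rule sum.mono_neutral_left) (use zero assms(1) in auto)
  then show ?thesis using zero assms(3) by (auto simp: partitions_def)
qed

text \<open>Each index beyond \<open>k\<close> has multiplicity 0 and contributes the factor
  \<open>i ^ 0 * fact 0 = 1\<close>.\<close>

lemma Sym_extend:
  assumes "q \<in> partitions k" "k \<le> n"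
  shows "Sym n q = Sym k q"
  unfolding Sym_def
  by (rule prod.mono_neutral_right) (use assms in \<open>auto simp: partitions_def\<close>)

lemma sum_partitions_extend:
  assumes "q \<in> partitions k" "k \<le> n"
  shows "(\<Sum>i=1..n. i * q i) = k"
proof -
  have "(\<Sum>i=1..n. i * q i) = (\<Sum>i=1..k. i * q i)"
    by (rule sum.mono_neutral_right) (use assms in \<open>auto simp: partitions_def\<close>)
  then show ?thesis using assms by (simp add: partitions_def)
qed

text \<open>The index 1 contributes \<open>p 1\<close> to the sum and
  \<open>1 ^ p 1 * fact (p 1)\<close> to the product. Applied to \<open>q(1 := n - k)\<close>, the
  same equations describe the insertion of ones.\<close>

lemma split_ones:
  assumes "n \<ge> 1"
  shows "(\<Sum>i=1..n. i * p i) = p 1 + (\<Sum>i=1..n. i * (p(1 := 0)) i)"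
    and "Sym n p = fact (p 1) * Sym n (p(1 := 0))"
proof -
  have "(\<Sum>i=1..n. i * p i) = p 1 + (\<Sum>i\<in>{1..n}-{1}. i * p i)"
    using assms by (subst sum.remove[of _ 1]) auto
  moreover have "(\<Sum>i=1..n. i * (p(1 := 0)) i) = (\<Sum>i\<in>{1..n}-{1}. i * p i)"
    using assms by (subst sum.remove[of _ 1]) (auto intro!: sum.cong)
  ultimately show "(\<Sum>i=1..n. i * p i) = p 1 + (\<Sum>i=1..n. i * (p(1 := 0)) i)"
    by simp
  have "Sym n p = fact (p 1) * (\<Prod>i\<in>{1..n}-{1}. i ^ p i * fact (p i))"
    unfolding Sym_def using assms by (subst prod.remove[of _ 1]) auto
  moreover have "Sym n (p(1 := 0)) = (\<Prod>i\<in>{1..n}-{1}. i ^ p i * fact (p i))"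
    unfolding Sym_def using assms by (subst prod.remove[of _ 1]) (auto intro!: prod.cong)
  ultimately show "Sym n p = fact (p 1) * Sym n (p(1 := 0))"
    by simp
qed

text \<open>A partition \<open>p\<close> of \<open>n\<close> corresponds to the pair of
  \<open>k = n - p 1\<close> and \<open>p(1 := 0)\<close>, a partition of \<open>k\<close> without
  ones. The \<open>n - k\<close> removed ones account for the factor
  \<open>fact (n - k)\<close>.\<close>

lemma Z3_eq_sum_no_one_sum:
  assumes "n \<ge> 1"
  shows "Z3 n = (\<Sum>k\<le>n. fact (n - k) * no_one_sum k)"
proof -
  have "(\<Sum>k\<le>n. fact (n - k) * no_one_sum k) =
        (\<Sum>(k, q)\<in>Sigma {..n} no_one_partitions. fact (n - k) * Sym k q)"
    by (simp add: no_one_sum_def sum_distrib_left sum.Sigma finite_no_one_partitions)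
  also have "\<dots> = (\<Sum>p\<in>partitions n. Sym n p)"
  proof (rule sum.reindex_bij_witness[where j = "\<lambda>(k, q). q(1 := n - k)" and
        i = "\<lambda>p. (n - p 1, p(1 := 0))"], goal_cases)
    case (1 a)
    then show ?case by (auto simp: no_one_partitions_def)
  next
    case (2 a)
    obtain k q where a: "a = (k, q)" by force
    with 2 have k: "k \<le> n" and q: "q \<in> partitions k" and q1: "q 1 = 0"
      by (auto simp: no_one_partitions_def)
    have upd: "q(1 := n - k, 1 := 0) = q" using q1 by auto
    have "(\<Sum>i=1..n. i * (q(1 := n - k)) i) = n - k + (\<Sum>i=1..n. i * q i)"
      using split_ones(1)[OF assms, of "q(1 := n - k)"] unfolding upd by simp
    also have "\<dots> = n" using sum_partitions_extend[OF q k] k by simp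
    finally have "q(1 := n - k) \<in> partitions n"
      using q k assms by (auto simp: partitions_def)
    then show ?case by (simp add: a)
  next
    case (3 p)
    then show ?case using partitions_mult_le[of p n 1] by simp
  next
    case (4 p)
    have "(\<Sum>i=1..n. i * (p(1 := 0)) i) = n - p 1"
      using split_ones(1)[OF assms, of p] 4 unfolding partitions_def by (metis (mono_tags, lifting) mem_Collect_eq diff_add_inverse)
    then have "p(1 := 0) \<in> partitions (n - p 1)"
      using 4 by (intro partitionsI[of _ n]) (auto simp: partitions_def)
    then show ?case by (simp add: no_one_partitions_def)
  next
    case (5 a)
    obtain k q where a: "a = (k, q)" by force
    with 5 have k: "k \<le> n" and q: "q \<in> partitions k" and q1: "q 1 = 0"
      by (auto simp: no_one_partitions_def)
    have upd: "q(1 := n - k, 1 := 0) = q" using q1 by auto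
    show ?case
      using split_ones(2)[OF assms, of "q(1 := n - k)"] Sym_extend[OF q k]
      unfolding upd by (simp add: a)
  qed
  finally show ?thesis by (simp add: Z3_def)
qed

section \<open>Growth of the sum over partitions without ones\<close>

lemma prod_fact_le_fact_sum:
  fixes f :: "'a \<Rightarrow> nat"
  assumes "finite A"
  shows "(\<Prod>i\<in>A. fact (f i)) \<le> (fact (\<Sum>i\<in>A. f i) :: nat)"
  using assms
proof induction
  case (insert x A)
  then have "(\<Prod>i\<in>insert x A. fact (f i)) \<le> fact (f x) * (fact (\<Sum>i\<in>A. f i) :: nat)"
    by simp
  also have "\<dots> \<le> fact (f x + (\<Sum>i\<in>A. f i))"
    by (intro dvd_imp_le fact_fact_dvd_fact) auto
  finally show ?case using insert by simp
qed auto

text \<open>From \<open>i \<le> 2 ^ i\<close>, the powers multiply to at most 2 to the exponent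
  \<open>\<Sum>i. i * q i = k\<close>. All parts being at least 2, there are at most
  \<open>k div 2\<close> of them, which bounds the product of the factorials.\<close>

lemma Sym_no_one_partition_le:
  assumes "q \<in> no_one_partitions k"
  shows "Sym k q \<le> 2 ^ k * fact (k div 2)"
proof -
  have q: "(\<Sum>i=1..k. i * q i) = k" "q 1 = 0"
    using assms by (auto simp: no_one_partitions_def partitions_def)
  have "2 * (\<Sum>i=1..k. q i) \<le> (\<Sum>i=1..k. i * q i)"
    unfolding sum_distrib_left
  proof (rule sum_mono)
    fix i assume "i \<in> {1..k}"
    then show "2 * q i \<le> i * q i" using q(2) by (cases "i = 1") auto
  qed
  then have parts: "(\<Sum>i=1..k. q i) \<le> k div 2" using q(1) by simp
  have "(\<Prod>i=1..k. i ^ q i) \<le> (\<Prod>i=1..k. 2 ^ (i * q i))"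
  proof (rule prod_mono)
    fix i
    have "i ^ q i \<le> (2 ^ i) ^ q i"
      by (intro power_mono) (auto intro: less_imp_le)
    then show "0 \<le> i ^ q i \<and> i ^ q i \<le> 2 ^ (i * q i)"
      by (simp add: power_mult)
  qed
  also have "\<dots> = 2 ^ k" using q(1) by (simp add: power_sum [symmetric])
  finally have pow: "(\<Prod>i=1..k. i ^ q i) \<le> 2 ^ k" .
  have "(\<Prod>i=1..k. fact (q i)) \<le> (fact (\<Sum>i=1..k. q i) :: nat)"
    by (rule prod_fact_le_fact_sum) simp
  also have "\<dots> \<le> fact (k div 2)" using parts by (rule fact_mono)
  finally show ?thesis
    using pow unfolding Sym_def prod.distrib by (intro mult_mono) auto
qed

text \<open>The multiplicity of \<open>i\<close> is at most \<open>n div i\<close>, so the count is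
  at most the product of \<open>1 + n / i = (n + i) / i\<close> over \<open>i\<close>, which is the
  central binomial coefficient.\<close>

lemma card_partitions_le: "card (partitions n) \<le> 4 ^ n"
proof -
  \<comment> \<open>Elements of a \<open>PiE\<close> set are \<open>undefined\<close> off the index
    set, whereas partitions are 0 there; hence the restriction.\<close>
  have inj: "inj_on (\<lambda>p. restrict p {1..n}) (partitions n)"
  proof (rule inj_onI, rule ext)
    fix p q i
    assume p: "p \<in> partitions n" and q: "q \<in> partitions n" and eq: "restrict p {1..n} = restrict q {1..n}"
    show "p i = q i"
    proof (cases "i \<in> {1..n}")
      case True
      then have "p i = restrict p {1..n} i" by simp
      also have "\<dots> = q i" unfolding eq using True by simp
      finally show ?thesis .
    qed (use p q in \<open>auto simp: partitions_def\<close>)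
  qed
  have "(\<lambda>p. restrict p {1..n}) ` partitions n \<subseteq> (\<Pi>\<^sub>E i\<in>{1..n}. {..n div i})"
  proof (rule image_subsetI)
    fix p assume "p \<in> partitions n"
    from partitions_mult_le[OF this] show "restrict p {1..n} \<in> (\<Pi>\<^sub>E i\<in>{1..n}. {..n div i})"
      by (auto simp: less_eq_div_iff_mult_less_eq mult.commute)
  qed
  then have "card (partitions n) \<le> card (\<Pi>\<^sub>E i\<in>{1..n}. {..n div i})"
    by (intro card_inj_on_le[OF inj] finite_PiE) auto
  also have "\<dots> = (\<Prod>i=1..n. Suc (n div i))"
    by (simp add: card_PiE)
  finally have card: "card (partitions n) \<le> (\<Prod>i=1..n. Suc (n div i))" .
  \<comment> \<open>Division is avoided: one \<open>fact n\<close> clears the denominators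
    \<open>i\<close>, the other completes the product of the \<open>n + i\<close> to
    \<open>fact (n + n)\<close>.\<close>
  have "card (partitions n) * fact n * fact n \<le> (\<Prod>i=1..n. Suc (n div i)) * \<Prod>{1..n} * fact n"
    using card by (simp add: fact_prod)
  also have "\<dots> = (\<Prod>i=1..n. i * Suc (n div i)) * fact n"
    by (simp add: prod.distrib mult_ac del: mult_Suc_right)
  also have "\<dots> \<le> (\<Prod>i=1..n. n + i) * fact n"
    by (intro mult_right_mono prod_mono) (auto simp: add.commute)
  also have "(\<Prod>i=1..n. n + i) = \<Prod>{n + 1..n + n}"
    using prod.shift_bounds_cl_nat_ivl[of "\<lambda>i. i" 1 n n] by (simp add: add.commute)
  also have "\<dots> * fact n = fact (n + n)"
    using prod.ub_add_nat[of 1 n "\<lambda>i. i" n] by (simp add: fact_prod mult.commute)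
  also have "\<dots> = fact n * fact n * ((n + n) choose n)"
    using binomial_fact_lemma[of n "n + n"] by simp
  finally have "card (partitions n) \<le> (n + n) choose n"
    by (simp add: mult_ac)
  also have "\<dots> \<le> 2 ^ (n + n)" by (rule binomial_le_pow2)
  also have "\<dots> = 4 ^ n" by (simp flip: mult_2 add: power_mult)
  finally show ?thesis .
qed

lemma no_one_sum_le: "no_one_sum k \<le> 8 ^ k * fact (k div 2)"
proof -
  have "no_one_sum k \<le> card (no_one_partitions k) * (2 ^ k * fact (k div 2))"
    unfolding no_one_sum_def using sum_bounded_above[OF Sym_no_one_partition_le] by simp
  also have "card (no_one_partitions k) \<le> card (partitions k)"
    by (intro card_mono finite_partitions) (auto simp: no_one_partitions_def)
  also have "\<dots> \<le> 4 ^ k" by (rule card_partitions_le)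
  also have "4 ^ k * (2 ^ k * fact (k div 2)) = (8 ^ k * fact (k div 2) :: nat)"
    by (simp add: power_mult_distrib [symmetric])
  finally show ?thesis by simp
qed

section \<open>Convergence of the majorant series\<close>

lemma power_le_fact_mult_exp:
  fixes x :: real
  assumes "x \<ge> 0"
  shows "x ^ m \<le> fact m * exp x"
proof -
  have "(\<Sum>j\<in>{m}. x ^ j /\<^sub>R fact j) \<le> (\<Sum>j. x ^ j /\<^sub>R fact j)"
    by (rule sum_le_suminf[OF summable_exp_generic]) (use assms in auto)
  then show ?thesis by (simp add: exp_def field_simps)
qed

text \<open>The exponential bound is used twice: it gives
  \<open>k ^ m \<le> fact m * exp 1 ^ k\<close>, and it makes \<open>fact (k div 2)\<close> at least
  a constant times \<open>y ^ k\<close> for a \<open>y\<close> of choice. A geometric series then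
  dominates.\<close>

lemma summable_power_div_fact_half:
  fixes x :: real
  assumes "x > 0"
  shows "summable (\<lambda>k. real k ^ m * x ^ k / fact (k div 2))"
proof (rule summable_comparison_test')
  \<comment> \<open>This \<open>y\<close> makes the ratio \<open>x * exp 1 / y\<close> less than 1,
    and \<open>y > 1\<close> allows exponents to be increased.\<close>
  define y where "y = 2 * x * exp 1 + 1"
  have y: "y > 1" using assms by (simp add: y_def)
  define C where "C = fact m * exp (y\<^sup>2) * y"
  have "0 < x * exp 1" using assms by simp
  then have "x * exp 1 / y < 1" unfolding y_def by (subst divide_less_eq) auto
  then show "summable (\<lambda>k. C * (x * exp 1 / y) ^ k)"
    using assms y by (intro summable_mult summable_geometric) auto
  fix k :: nat
  \<comment> \<open>The extra 1 in the exponent covers odd \<open>k\<close>, where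
    \<open>2 * (k div 2) = k - 1\<close>.\<close>
  have "y ^ k \<le> y ^ (2 * (k div 2) + 1)"
    using y by (intro power_increasing) auto
  also have "\<dots> = (y\<^sup>2) ^ (k div 2) * y" by (simp add: power_mult)
  also have "\<dots> \<le> fact (k div 2) * exp (y\<^sup>2) * y"
    using y by (intro mult_right_mono power_le_fact_mult_exp) auto
  finally have fact: "y ^ k \<le> fact (k div 2) * exp (y\<^sup>2) * y" .
  have "1 / fact (k div 2) \<le> exp (y\<^sup>2) * y / y ^ k"
    using fact y by (simp add: field_simps)
  moreover have "real k ^ m * x ^ k \<le> fact m * exp 1 ^ k * x ^ k"
    using power_le_fact_mult_exp[of "real k" m] assms
    by (intro mult_right_mono) (auto simp flip: exp_of_nat_mult)
  ultimately have "real k ^ m * x ^ k * (1 / fact (k div 2)) \<le>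
      fact m * exp 1 ^ k * x ^ k * (exp (y\<^sup>2) * y / y ^ k)"
    using assms by (intro mult_mono) auto
  also have "\<dots> = C * (x * exp 1 / y) ^ k"
    by (simp add: C_def power_mult_distrib power_divide)
  finally show "norm (real k ^ m * x ^ k / fact (k div 2)) \<le> C * (x * exp 1 / y) ^ k"
    using assms by simp
qed

text \<open>The square of \<open>fact (k div 2)\<close> is at most \<open>fact k\<close>, so
  dividing the bound on \<open>W(k)\<close> by \<open>fact k\<close> leaves
  \<open>8 ^ k / fact (k div 2)\<close>.\<close>

lemma summable_no_one_sum: "summable (\<lambda>k. real k ^ m * (real (no_one_sum k) / fact k))"
proof (rule summable_comparison_test')
  show "summable (\<lambda>k. real k ^ m * 8 ^ k / fact (k div 2))"
    by (rule summable_power_div_fact_half) simp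
  fix k :: nat
  have "fact (k div 2) * fact (k div 2) \<le> (fact (k div 2 + k div 2) :: nat)"
    by (intro dvd_imp_le fact_fact_dvd_fact) auto
  also have "\<dots> \<le> fact k" by (intro fact_mono) auto
  finally have "real (fact (k div 2) * fact (k div 2)) \<le> real (fact k)"
    by (rule of_nat_mono)
  then have "fact (k div 2) / fact k \<le> (1 / fact (k div 2) :: real)"
    by (simp add: field_simps)
  then have "8 ^ k * (fact (k div 2) / fact k) \<le> (8 ^ k * (1 / fact (k div 2)) :: real)"
    by (rule mult_left_mono) simp
  moreover have "real (no_one_sum k) \<le> 8 ^ k * fact (k div 2)"
    using of_nat_mono[OF no_one_sum_le[of k], where 'a = real] by simp
  then have "real (no_one_sum k) / fact k \<le> 8 ^ k * fact (k div 2) / fact k"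
    by (rule divide_right_mono) simp
  ultimately have "real (no_one_sum k) / fact k \<le> 8 ^ k / fact (k div 2)"
    by simp
  then have "real k ^ m * (real (no_one_sum k) / fact k) \<le> real k ^ m * (8 ^ k / fact (k div 2))"
    by (rule mult_left_mono) simp
  then show "norm (real k ^ m * (real (no_one_sum k) / fact k)) \<le> real k ^ m * 8 ^ k / fact (k div 2)"
    by simp
qed

section \<open>Common form of both sums and the error term\<close>

lemma no_one_sum_0: "no_one_sum 0 = 1"
proof -
  have "no_one_partitions 0 = {\<lambda>_. 0}"
    by (auto simp: no_one_partitions_def partitions_def)
  then show ?thesis by (simp add: no_one_sum_def Sym_def)
qed

lemma no_one_sum_1: "no_one_sum (Suc 0) = 0"
proof -
  have "no_one_partitions (Suc 0) = {}"
    by (auto simp: no_one_partitions_def partitions_def)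
  then show ?thesis by (simp add: no_one_sum_def)
qed

lemma prod_falling_eq:
  assumes "k \<le> n"
  shows "(\<Prod>i<k. real n - real i) = fact k * real (n choose k)"
  using assms by (simp add: binomial_gbinomial gbinomial_prod_rev atLeast0LessThan)

text \<open>The leading 1 is the term \<open>k = 0\<close>, and the term \<open>k = 1\<close>
  vanishes. For \<open>K \<le> n\<close>, every falling factorial in the sum is
  \<open>fact k * (n choose k)\<close>.\<close>

lemma S31_eq:
  assumes "K \<le> n"
  shows "S31 K n / fact n = (\<Sum>k\<le>K. real (no_one_sum k) / fact k / real (n choose k))"
proof -
  define f where "f k = real (no_one_sum k) / fact k / real (n choose k)" for k
  have "S31 K n / fact n = 1 + (\<Sum>k=2..K. f k)"
    using assms unfolding S31_def f_def
    by (auto simp: prod_falling_eq no_one_sum_def no_one_partitions_def intro!: sum.cong)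
  also have "\<dots> = (\<Sum>k\<in>insert 0 {2..K}. f k)"
    by (simp add: f_def no_one_sum_0)
  also have "\<dots> = (\<Sum>k\<le>K. f k)"
  proof (rule sum.mono_neutral_left)
    show "\<forall>k\<in>{..K} - insert 0 {2..K}. f k = 0"
    proof
      fix k assume "k \<in> {..K} - insert 0 {2..K}"
      then have "k = Suc 0" by auto
      then show "f k = 0" by (simp add: f_def no_one_sum_1)
    qed
  qed auto
  finally show ?thesis by (simp add: f_def)
qed

lemma Z3_div_fact_eq:
  assumes "n \<ge> 1"
  shows "real (Z3 n) / fact n = (\<Sum>k\<le>n. real (no_one_sum k) / fact k / real (n choose k))"
  unfolding Z3_eq_sum_no_one_sum[OF assms] of_nat_sum sum_divide_distrib
  by (rule sum.cong) (auto simp: binomial_fact)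

lemma power_div_binomial_le:
  assumes "m \<le> k" "k \<le> n" "k \<ge> 1"
  shows "real n ^ m / real (n choose k) \<le> real k ^ m"
proof -
  have "(real n / real k) ^ m \<le> (real n / real k) ^ k"
    using assms by (intro power_increasing) auto
  also have "\<dots> \<le> real (n choose k)"
    using assms by (intro binomial_ge_n_over_k_pow_k) auto
  finally show ?thesis
    using assms by (simp add: field_simps power_divide)
qed

theorem theorem3:
  fixes K :: nat
  shows "(\<lambda>n. real n ^ K * (real (Z3 n) / fact n - S31 K n / fact n)) \<longlonglongrightarrow> 0"
proof (rule tendsto_0_le)
  define a where "a k = real (no_one_sum k) / fact k" for k
  \<comment> \<open>The exponent \<open>Suc K\<close>, one more than the statement asks for, leaves
    the factor \<open>1 / n\<close> that tends to 0.\<close>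
  define M where "M = (\<Sum>k. real k ^ Suc K * a k)"
  show "(\<lambda>n. M / real n) \<longlonglongrightarrow> 0"
    by (rule lim_const_over_n)
  show "\<forall>\<^sub>F n in sequentially.
      norm (real n ^ K * (real (Z3 n) / fact n - S31 K n / fact n)) \<le> norm (M / real n) * 1"
    \<comment> \<open>From here on \<open>n \<ge> 1\<close> and \<open>K \<le> n\<close>, so both
      sums have their common form and division by \<open>n\<close> is allowed.\<close>
    using eventually_ge_at_top[of "Suc K"]
  proof eventually_elim
    case (elim n)
    have ivl: "{..n} - {..K} = {Suc K..n}" by auto
    have diff: "real (Z3 n) / fact n - S31 K n / fact n =
        (\<Sum>k=Suc K..n. a k / real (n choose k))"
      using elim Z3_div_fact_eq[of n] S31_eq[of K n]
      by (simp add: a_def sum_diff flip: ivl)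
    have "real n ^ Suc K * (\<Sum>k=Suc K..n. a k / real (n choose k)) =
        (\<Sum>k=Suc K..n. real n ^ Suc K / real (n choose k) * a k)"
      by (simp add: sum_distrib_left)
    also have "\<dots> \<le> (\<Sum>k=Suc K..n. real k ^ Suc K * a k)"
      by (intro sum_mono mult_right_mono power_div_binomial_le) (auto simp: a_def)
    also have "\<dots> \<le> M"
      unfolding M_def a_def by (intro sum_le_suminf summable_no_one_sum) auto
    finally have "real n ^ K * (\<Sum>k=Suc K..n. a k / real (n choose k)) \<le> M / real n"
      using elim by (simp add: field_simps)
    \<comment> \<open>The error is nonnegative, so the upper bound alone controls its norm.\<close>
    moreover have "0 \<le> (\<Sum>k=Suc K..n. a k / real (n choose k))"
      by (intro sum_nonneg) (auto simp: a_def)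
    ultimately show ?case
      unfolding diff using order_trans[OF _ abs_ge_self[of "M / real n"]] by simp
  qed
qed

end
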